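(* There exists a $2n\times 2n$ normal matrix $N$ of the form $$N=\begin{bmatrix} A & B\\ C & D\end{bmatrix},$$ partitioned into blocks $A,B,C,D$ of size $n\times n$, with $$\|B\|=\sqrt{n}\,\|C\|$$ if and only if $n\le 3$.
   Context: Here $n$ is a positive integer and matrices have complex entries. For an $m\times m$ matrix $T$, $\|T\|=\sup_{x\in\mathbb{C}^m,\ \|x\|=1}\|Tx\|$ denotes the norm of $T$ as a linear operator on the Euclidean space $\mathbb{C}^m$, i.e. its largest singular value. A square matrix $N$ is normal if $N^*N=NN^*$.
   Formalization: The block B is additionally required to be nonzero; without this the claim fails for every n ≥ 4, since N = 0 is normal and satisfies ‖B‖ = 0 = √n‖C‖. *)

theory Defs
  imports "HOL-Analysis.Analysis"
begin

definition block_mat ::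
  "'a^'n^'n \<Rightarrow> 'a^'n^'n \<Rightarrow> 'a^'n^'n \<Rightarrow> 'a^'n^'n \<Rightarrow> 'a^('n + 'n)^('n + 'n)" where
  "block_mat A B C D = (\<chi> i j. case i of
      Inl k \<Rightarrow> (case j of Inl l \<Rightarrow> A $ k $ l | Inr l \<Rightarrow> B $ k $ l)
    | Inr k \<Rightarrow> (case j of Inl l \<Rightarrow> C $ k $ l | Inr l \<Rightarrow> D $ k $ l))"

definition conj_transpose :: "complex^'n^'m \<Rightarrow> complex^'m^'n" where
  "conj_transpose M = (\<chi> i j. cnj (M $ j $ i))"

definition normal_matrix :: "complex^'n^'n \<Rightarrow> bool" where
  "normal_matrix M \<longleftrightarrow> conj_transpose M ** M = M ** conj_transpose M"

text \<open>The norm on \<^typ>\<open>complex^'n\<close> is the Euclidean one, so \<open>onorm\<close> of the map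
  \<open>\<lambda>x. M *v x\<close> is the supremum of the Euclidean norms of \<open>M *v x\<close> over unit vectors \<open>x\<close>.\<close>

definition mat_norm :: "complex^'n^'m \<Rightarrow> real" where
  "mat_norm M = onorm (\<lambda>x. M *v x)"

end

theory Submission
  imports Defs
begin

text \<open>
  Write \<open>n\<close> for the size of the blocks, \<open>\<parallel>\<cdot>\<parallel>\<^sub>F\<close> for the Frobenius norm and \<open>M\<^sup>*\<close> for the conjugate
  transpose (in formulas of the theory, \<open>M\<^sup>H\<close>). Normality of the block matrix amounts to the three
  equations of \<open>normal_block_mat_iff\<close>. The trace of the first gives \<open>\<parallel>B\<parallel>\<^sub>F = \<parallel>C\<parallel>\<^sub>F\<close>, whence
  \<open>\<parallel>B\<parallel> \<le> \<parallel>B\<parallel>\<^sub>F = \<parallel>C\<parallel>\<^sub>F \<le> \<surd>n \<parallel>C\<parallel>\<close> for every normal matrix. The theorem asks when this bound is attained.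

  If it is, then \<open>B\<close> has rank one and \<open>C\<close> is a scalar multiple \<open>c U\<close> of a unitary matrix
  (\<open>extremal_corners\<close>). Take \<open>x\<close> with \<open>B\<^sup>* x = 0\<close> and \<open>B C x = 0\<close>. On such an \<open>x\<close> the first equation says
  that \<open>\<parallel>A x\<parallel>\<^sup>2\<close> falls short of \<open>\<parallel>A\<^sup>* x\<parallel>\<^sup>2\<close> by \<open>c\<^sup>2 \<parallel>x\<parallel>\<^sup>2\<close>, and the third one that \<open>\<parallel>D y\<parallel>\<^sup>2\<close> exceeds
  \<open>\<parallel>D\<^sup>* y\<parallel>\<^sup>2\<close> by \<open>c\<^sup>2 \<parallel>y\<parallel>\<^sup>2\<close> for \<open>y = C x\<close>. But the second equation says that \<open>D\<close> is \<open>U A U\<^sup>*\<close> up to a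
  perturbation built from \<open>B\<close>, hence of small rank. So the perturbation has to account for two defects of
  opposite sign, and \<open>defect_identity\<close> computes its contribution exactly: up to a positive factor it is
  \<open>|\<phi> - 2 \<psi>|\<^sup>2 + (n - 4) |\<psi> - \<phi>|\<^sup>2\<close> for two linear functionals \<open>\<phi>\<close> and \<open>\<psi>\<close> of \<open>x\<close>. The number
  \<open>4\<close> enters here: for \<open>n = 4\<close> the form degenerates to a single square, so that three linear conditions on
  \<open>x\<close>, including the two above, make it vanish, and for \<open>n \<ge> 5\<close> four conditions do. Either way they have a
  nonzero solution \<open>x\<close>, a contradiction (\<open>no_extremal_normal_block_mat\<close>).

  For \<open>n \<le> 3\<close> there are explicit examples with \<open>C = 1\<close> and a single nonzero entry \<open>\<surd>n\<close> in \<open>B\<close>. They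
  are found by letting \<open>A\<close> and \<open>D\<close> be weighted cyclic shifts, for which \<open>A\<^sup>* A - A A\<^sup>*\<close> is diagonal.
\<close>

section \<open>Normality of a block matrix\<close>

notation conj_transpose ("_\<^sup>H" [1000] 999)

lemma sum_UNIV_Plus:
  fixes g :: "'a::finite + 'b::finite \<Rightarrow> 'c::comm_monoid_add"
  shows "(\<Sum>k\<in>UNIV. g k) = (\<Sum>k\<in>UNIV. g (Inl k)) + (\<Sum>k\<in>UNIV. g (Inr k))"
  by (simp add: UNIV_Plus_UNIV[symmetric] sum.Plus del: UNIV_Plus_UNIV)

lemma block_mat_mult:
  fixes A B C D :: "complex^'n::finite^'n"
  shows "block_mat A B C D ** block_mat A' B' C' D' =
    block_mat (A ** A' + B ** C') (A ** B' + B ** D') (C ** A' + D ** C') (C ** B' + D ** D')"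
  by (auto simp: block_mat_def matrix_matrix_mult_def vec_eq_iff sum_UNIV_Plus split: sum.splits)

lemma conj_transpose_block_mat:
  "(block_mat A B C D)\<^sup>H = block_mat (A\<^sup>H) (C\<^sup>H) (B\<^sup>H) (D\<^sup>H)"
  by (auto simp: block_mat_def conj_transpose_def vec_eq_iff split: sum.splits)

lemma block_mat_eq_iff:
  "block_mat A B C D = block_mat A' B' C' D' \<longleftrightarrow> A = A' \<and> B = B' \<and> C = C' \<and> D = D'"
proof
  assume *: "block_mat A B C D = block_mat A' B' C' D'"
  have "block_mat A B C D $ i $ j = block_mat A' B' C' D' $ i $ j" for i j
    using * by simp
  from this[of "Inl _" "Inl _"] this[of "Inl _" "Inr _"] this[of "Inr _" "Inl _"] this[of "Inr _" "Inr _"]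
  show "A = A' \<and> B = B' \<and> C = C' \<and> D = D'"
    by (simp add: block_mat_def vec_eq_iff)
qed simp

lemma conj_transpose_conj_transpose [simp]: "(M\<^sup>H)\<^sup>H = M"
  by (simp add: conj_transpose_def vec_eq_iff)

lemma conj_transpose_add: "(M + N)\<^sup>H = M\<^sup>H + N\<^sup>H"
  by (simp add: conj_transpose_def vec_eq_iff)

lemma conj_transpose_mult: "(M ** N)\<^sup>H = N\<^sup>H ** M\<^sup>H"
  by (simp add: conj_transpose_def matrix_matrix_mult_def vec_eq_iff mult.commute)

lemma normal_block_mat_iff:
  fixes A B C D :: "complex^'n::finite^'n"
  shows "normal_matrix (block_mat A B C D) \<longleftrightarrow>
    A\<^sup>H ** A + C\<^sup>H ** C = A ** A\<^sup>H + B ** B\<^sup>H \<and>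
    A\<^sup>H ** B + C\<^sup>H ** D = A ** C\<^sup>H + B ** D\<^sup>H \<and>
    B\<^sup>H ** B + D\<^sup>H ** D = C ** C\<^sup>H + D ** D\<^sup>H"
proof -
  have "B\<^sup>H ** A + D\<^sup>H ** C = C ** A\<^sup>H + D ** B\<^sup>H"
    if "A\<^sup>H ** B + C\<^sup>H ** D = A ** C\<^sup>H + B ** D\<^sup>H"
    using arg_cong[OF that, of conj_transpose] by (simp add: conj_transpose_add conj_transpose_mult)
  then show ?thesis
    unfolding normal_matrix_def conj_transpose_block_mat block_mat_mult block_mat_eq_iff by blast
qed

section \<open>Adjoints, operator norm and Frobenius norm\<close>

text \<open>The complex inner product on column vectors, conjugate linear in the first argument; the library
  inner product on the same type is real and is its real part.\<close>

definition cdot :: "complex^'n \<Rightarrow> complex^'n \<Rightarrow> complex" where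
  "cdot v x = (\<Sum>i\<in>UNIV. cnj (v $ i) * x $ i)"

lemma inner_eq_Re_cdot: "x \<bullet> y = Re (cdot x y)"
  by (simp add: inner_vec_def inner_complex_def cdot_def)

lemma cdot_conj_transpose:
  fixes M :: "complex^'n::finite^'m::finite"
  shows "cdot (M *v x) y = cdot x (M\<^sup>H *v y)"
proof -
  have "cdot (M *v x) y = (\<Sum>i\<in>UNIV. \<Sum>j\<in>UNIV. cnj (x $ j) * (cnj (M $ i $ j) * y $ i))"
    by (simp add: cdot_def matrix_vector_mult_def sum_distrib_left sum_distrib_right mult_ac)
  also have "\<dots> = cdot x (M\<^sup>H *v y)"
    by (subst sum.swap) (simp add: cdot_def matrix_vector_mult_def conj_transpose_def sum_distrib_left)
  finally show ?thesis .
qed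

lemma inner_conj_transpose:
  fixes M :: "complex^'n::finite^'m::finite"
  shows "(M *v x) \<bullet> y = x \<bullet> (M\<^sup>H *v y)"
  by (simp add: inner_eq_Re_cdot cdot_conj_transpose)

lemma matrix_vector_mult_scaleR:
  fixes M :: "complex^'n::finite^'m::finite"
  shows "M *v (r *\<^sub>R x) = r *\<^sub>R (M *v x)"
  by (simp add: matrix_vector_mult_def vec_eq_iff scaleR_sum_right)

lemma bounded_linear_matrix:
  fixes M :: "complex^'n::finite^'m::finite"
  shows "bounded_linear (\<lambda>x. M *v x)"
  unfolding linear_conv_bounded_linear[symmetric]
  by (rule linearI) (simp_all add: matrix_vector_right_distrib matrix_vector_mult_scaleR)

lemma norm_matrix_vector_le:
  fixes M :: "complex^'n::finite^'m::finite"
  shows "norm (M *v x) \<le> mat_norm M * norm x"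
  unfolding mat_norm_def by (rule onorm[OF bounded_linear_matrix])

lemma mat_norm_attained:
  fixes M :: "complex^'n::finite^'m::finite"
  obtains v where "norm v = 1" "norm (M *v v) = mat_norm M"
proof -
  let ?S = "sphere 0 1 :: (complex^'n) set"
  have "axis undefined 1 \<in> ?S"
    by simp
  then have "?S \<noteq> {}"
    by blast
  moreover have "continuous_on ?S (\<lambda>x. norm (M *v x))"
    by (intro continuous_on_norm linear_continuous_on bounded_linear_matrix)
  ultimately obtain v where v: "v \<in> ?S" "\<forall>y\<in>?S. norm (M *v y) \<le> norm (M *v v)"
    using continuous_attains_sup[OF compact_sphere] by blast
  have "norm (M *v x) \<le> norm (M *v v) * norm x" for x
  proof (cases "x = 0")
    case False
    then have "norm (M *v ((1 / norm x) *\<^sub>R x)) \<le> norm (M *v v)"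
      using v(2) by (intro v(2)[rule_format]) simp
    with False show ?thesis
      by (simp add: matrix_vector_mult_scaleR field_simps)
  qed simp
  then have "mat_norm M \<le> norm (M *v v)"
    unfolding mat_norm_def by (rule onorm_le)
  moreover have "norm (M *v v) \<le> mat_norm M"
    using norm_matrix_vector_le[of M v] v(1) by simp
  ultimately show ?thesis
    using that v(1) by simp
qed

text \<open>The library norm of a matrix, viewed as a vector of rows, is its Frobenius norm. This is the norm
  meant by \<open>norm\<close> of a matrix in the sequel, as opposed to the operator norm \<open>mat_norm\<close>.\<close>

lemma norm_vec_sq: "(norm (x :: 'a::real_normed_vector^'n::finite))\<^sup>2 = (\<Sum>i\<in>UNIV. (norm (x $ i))\<^sup>2)"
  by (simp add: norm_vec_def L2_set_def sum_nonneg)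

lemma norm_axis: "norm (axis i z :: 'a::real_normed_vector^'n::finite) = norm z"
proof -
  have "(norm (axis i z :: 'a^'n))\<^sup>2 = (norm z)\<^sup>2"
  proof -
    have "(\<Sum>p\<in>UNIV. (norm ((axis i z :: 'a^'n) $ p))\<^sup>2) = (\<Sum>p\<in>UNIV. if p = i then (norm z)\<^sup>2 else 0)"
      by (intro sum.cong) (auto simp: axis_def)
    then show ?thesis
      by (simp add: norm_vec_sq)
  qed
  then show ?thesis
    by simp
qed

lemma norm_matrix_sq_columns:
  fixes M :: "complex^'n::finite^'m::finite"
  shows "(norm M)\<^sup>2 = (\<Sum>j\<in>UNIV. (norm (M *v axis j 1))\<^sup>2)"
proof -
  have "(\<Sum>j\<in>UNIV. (norm (M *v axis j 1))\<^sup>2) = (\<Sum>j\<in>UNIV. \<Sum>i\<in>UNIV. (norm (M $ i $ j))\<^sup>2)"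
    by (simp add: norm_vec_sq matrix_vector_mult_def axis_def if_distrib cong: if_cong)
  also have "\<dots> = (norm M)\<^sup>2"
    by (subst sum.swap) (simp add: norm_vec_sq)
  finally show ?thesis ..
qed

lemma trace_conj_transpose_mult:
  fixes M :: "complex^'n::finite^'n"
  shows "trace (M\<^sup>H ** M) = of_real ((norm M)\<^sup>2)" "trace (M ** M\<^sup>H) = of_real ((norm M)\<^sup>2)"
proof -
  show *: "trace (M ** M\<^sup>H) = of_real ((norm M)\<^sup>2)"
    by (simp add: trace_def norm_vec_sq matrix_matrix_mult_def conj_transpose_def complex_norm_square
        del: of_real_power)
  then show "trace (M\<^sup>H ** M) = of_real ((norm M)\<^sup>2)"
    by (subst trace_mul_sym)
qed

text \<open>The trace of the equation: \<open>A\<^sup>* A\<close> and \<open>A A\<^sup>*\<close> have the same trace and cancel.\<close>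

lemma normal_block_mat_norm_eq:
  fixes A B C :: "complex^'n::finite^'n"
  assumes "A\<^sup>H ** A + C\<^sup>H ** C = A ** A\<^sup>H + B ** B\<^sup>H"
  shows "norm B = norm C"
proof -
  have "(of_real ((norm B)\<^sup>2) :: complex) = of_real ((norm C)\<^sup>2)"
    using arg_cong[OF assms, of trace] by (simp add: trace_add trace_conj_transpose_mult del: of_real_power)
  then have "(norm B)\<^sup>2 = (norm C)\<^sup>2"
    by (simp only: of_real_eq_iff)
  then show ?thesis
    by simp
qed

lemma norm_vector_scalar_mult:
  fixes x :: "complex^'n::finite"
  shows "norm (c *s x) = norm c * norm x"
proof -
  have "(norm (c *s x))\<^sup>2 = (norm c * norm x)\<^sup>2"
    by (simp add: norm_vec_sq norm_mult power_mult_distrib sum_distrib_left)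
  then show ?thesis
    by simp
qed

section \<open>Equality between the operator norm and the Frobenius norm\<close>

lemma parallelogram:
  fixes x y :: "'a::real_inner"
  shows "(norm (x + y))\<^sup>2 + (norm (x - y))\<^sup>2 = 2 * (norm x)\<^sup>2 + 2 * (norm y)\<^sup>2"
  by (simp add: power2_norm_eq_inner inner_add_left inner_add_right inner_diff_left inner_diff_right)

text \<open>The quadratic form \<open>q x = c\<^sup>2 \<parallel>x\<parallel>\<^sup>2 - \<parallel>M x\<parallel>\<^sup>2\<close> is nonnegative, and its sum over the standard basis
  is at most zero, so it vanishes on the basis. By the parallelogram identity the zeros of a
  nonnegative quadratic form are closed under addition; hence \<open>q = 0\<close>.\<close>

lemma scaled_isometry_if_norm_large:
  fixes M :: "complex^'n::finite^'m::finite"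
  assumes le: "\<And>x. norm (M *v x) \<le> c * norm x"
    and large: "real CARD('n) * c\<^sup>2 \<le> (norm M)\<^sup>2"
  shows "norm (M *v x) = c * norm x"
proof -
  define q where "q x = (c * norm x)\<^sup>2 - (norm (M *v x))\<^sup>2" for x
  have q_nonneg: "q x \<ge> 0" for x
    using le[of x] by (simp add: q_def power_mono)
  have "(\<Sum>j\<in>UNIV. q (axis j 1)) \<le> 0"
    using large by (simp add: q_def sum_subtractf norm_matrix_sq_columns[symmetric])
  then have "(\<Sum>j\<in>UNIV. q (axis j 1)) = 0"
    by (rule antisym[OF _ sum_nonneg[OF q_nonneg]])
  then have q_axis: "q (axis j 1) = 0" for j
    by (rule sum_nonneg_0[OF finite q_nonneg _ UNIV_I])
  have q_scale: "q (z *s x) = (norm z)\<^sup>2 * q x" for z x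
    by (simp add: q_def norm_vector_scalar_mult vector_scalar_commute power_mult_distrib algebra_simps)
  have q_parallelogram: "q (x + y) + q (x - y) = 2 * q x + 2 * q y" for x y
  proof -
    have "q (x + y) + q (x - y) = c\<^sup>2 * ((norm (x + y))\<^sup>2 + (norm (x - y))\<^sup>2) -
        ((norm (M *v x + M *v y))\<^sup>2 + (norm (M *v x - M *v y))\<^sup>2)"
      unfolding q_def matrix_vector_right_distrib matrix_vector_mult_diff_distrib power_mult_distrib
        distrib_left by (rule add_diff_add[symmetric])
    then show ?thesis
      unfolding parallelogram by (simp add: q_def power_mult_distrib algebra_simps)
  qed
  have q_add: "q (x + y) = 0" if "q x = 0" "q y = 0" for x y
    using q_parallelogram[of x y] q_nonneg[of "x + y"] q_nonneg[of "x - y"] that by linarith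
  have "q (\<Sum>j\<in>I. (x $ j) *s axis j 1) = 0" for I
    by (induction I rule: infinite_finite_induct) (simp_all add: q_add q_scale q_axis q_def[of 0])
  from this[of UNIV] have "(norm (M *v x))\<^sup>2 = (c * norm x)\<^sup>2"
    by (simp add: basis_expansion q_def)
  moreover have "0 \<le> c * norm x"
    using le[of x] norm_ge_zero order_trans by blast
  ultimately show ?thesis
    by simp
qed

text \<open>Polarization gives the first equation; the second follows because an injective endomorphism of a
  finite-dimensional space is surjective.\<close>

lemma scaled_isometry_adjoint:
  fixes M :: "complex^'n::finite^'n"
  assumes iso: "\<And>x. norm (M *v x) = c * norm x" and "c \<noteq> 0"
  shows "M\<^sup>H *v (M *v x) = c\<^sup>2 *\<^sub>R x" "M *v (M\<^sup>H *v x) = c\<^sup>2 *\<^sub>R x"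
proof -
  show *: "M\<^sup>H *v (M *v x) = c\<^sup>2 *\<^sub>R x" for x
  proof -
    have "(M\<^sup>H *v (M *v x) - c\<^sup>2 *\<^sub>R x) \<bullet> y = 0" for y
    proof -
      have "(M\<^sup>H *v (M *v x)) \<bullet> y = (M *v x) \<bullet> (M *v y)"
        by (simp add: inner_conj_transpose)
      also have "\<dots> = c\<^sup>2 * (x \<bullet> y)"
        by (simp add: dot_norm iso power_mult_distrib algebra_simps flip: matrix_vector_right_distrib)
      finally show ?thesis
        by (simp add: inner_diff_left)
    qed
    from this[of "M\<^sup>H *v (M *v x) - c\<^sup>2 *\<^sub>R x"] show ?thesis
      by simp
  qed
  have "inj (\<lambda>x. M *v x)"
    using * \<open>c \<noteq> 0\<close> by (metis injI scaleR_cancel_left zero_eq_power2)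
  then have "surj (\<lambda>x. M *v x)"
    by (rule eucl.linear_inj_imp_surj[OF bounded_linear.linear[OF bounded_linear_matrix]])
  then obtain y where "x = M *v y"
    by blast
  then show "M *v (M\<^sup>H *v x) = c\<^sup>2 *\<^sub>R x"
    by (simp add: * matrix_vector_mult_scaleR)
qed

definition outer :: "complex^'m \<Rightarrow> complex^'n \<Rightarrow> complex^'n^'m" where
  "outer w v = (\<chi> i j. w $ i * cnj (v $ j))"

lemma outer_mult_vec: "outer w v *v x = cdot v x *s w"
  by (simp add: outer_def cdot_def matrix_vector_mult_def vec_eq_iff sum_distrib_left mult_ac)

lemma conj_transpose_outer: "(outer w v)\<^sup>H = outer v w"
  by (simp add: outer_def conj_transpose_def vec_eq_iff mult.commute)

lemma cdot_scale: "cdot v (k *s x) = k * cdot v x"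
  by (simp add: cdot_def sum_distrib_left mult_ac)

lemma cdot_self: "cdot v v = of_real ((norm v)\<^sup>2)"
  by (simp add: cdot_def norm_vec_sq complex_norm_square mult.commute del: of_real_power)

lemma cdot_add: "cdot v (x + y) = cdot v x + cdot v y"
  and cdot_diff: "cdot v (x - y) = cdot v x - cdot v y"
  and cdot_scaleR: "cdot v (r *\<^sub>R x) = r *\<^sub>R cdot v x"
  by (simp_all add: cdot_def algebra_simps sum.distrib sum_subtractf scaleR_sum_right)

lemma norm_outer: "norm (outer w v) = norm w * norm v"
proof -
  have "(norm (outer w v))\<^sup>2 = (norm w * norm v)\<^sup>2"
    by (simp add: outer_def norm_vec_sq norm_mult power_mult_distrib sum_product)
  then show ?thesis
    by simp
qed

text \<open>Subtracting from \<open>M\<close> its restriction to the line of \<open>v\<close> lowers the squared Frobenius norm by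
  exactly \<open>\<parallel>M v\<parallel>\<^sup>2\<close>, so nothing is left.\<close>

lemma rank_one_if_norm_le:
  fixes M :: "complex^'n::finite^'m::finite"
  assumes v: "norm v = 1" and le: "norm M \<le> norm (M *v v)"
  shows "M = outer (M *v v) v"
proof -
  let ?w = "M *v v"
  have row: "(norm (M $ i - outer ?w v $ i))\<^sup>2 = (norm (M $ i))\<^sup>2 - (norm (?w $ i))\<^sup>2" for i
  proof -
    have wi: "?w $ i = (\<Sum>j\<in>UNIV. M $ i $ j * v $ j)"
      by (simp add: matrix_vector_mult_def)
    have vv: "(\<Sum>j\<in>UNIV. v $ j * cnj (v $ j)) = 1"
      using cdot_self[of v] v by (simp add: cdot_def mult.commute)
    have "complex_of_real ((norm (M $ i - outer ?w v $ i))\<^sup>2) =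
      (\<Sum>j\<in>UNIV. (M $ i $ j - ?w $ i * cnj (v $ j)) * cnj (M $ i $ j - ?w $ i * cnj (v $ j)))"
      by (simp add: norm_vec_sq outer_def complex_norm_square del: of_real_power)
    also have "\<dots> = (\<Sum>j\<in>UNIV. M $ i $ j * cnj (M $ i $ j)) - cnj (?w $ i) * (\<Sum>j\<in>UNIV. M $ i $ j * v $ j)
       - ?w $ i * cnj (\<Sum>j\<in>UNIV. M $ i $ j * v $ j)
       + ?w $ i * cnj (?w $ i) * (\<Sum>j\<in>UNIV. v $ j * cnj (v $ j))"
      by (simp add: algebra_simps sum.distrib sum_subtractf sum_distrib_left)
    also have "\<dots> = (\<Sum>j\<in>UNIV. M $ i $ j * cnj (M $ i $ j)) - ?w $ i * cnj (?w $ i)"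
      unfolding vv wi[symmetric] by (simp add: algebra_simps)
    also have "\<dots> = complex_of_real ((norm (M $ i))\<^sup>2 - (norm (?w $ i))\<^sup>2)"
      by (simp add: norm_vec_sq complex_norm_square del: of_real_power)
    finally show ?thesis
      by (simp only: of_real_eq_iff)
  qed
  have "(norm (M - outer ?w v))\<^sup>2 = (norm M)\<^sup>2 - (norm ?w)\<^sup>2"
    unfolding norm_vec_sq[of "M - outer ?w v"] norm_vec_sq[of M] norm_vec_sq[of ?w] vector_minus_component row
    by (simp add: sum_subtractf)
  also have "\<dots> \<le> 0"
    using le by (simp add: power_mono)
  finally show ?thesis
    by simp
qed

section \<open>Blocks of size at least four\<close>

lemma linear_has_kernel:
  fixes f :: "'a::euclidean_space \<Rightarrow> 'b::euclidean_space"
  assumes "linear f" "DIM('b) < DIM('a)"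
  obtains x where "x \<noteq> 0" "f x = 0"
proof -
  have "\<not> inj f"
  proof
    assume "inj f"
    then have "dim (range f) = DIM('a)"
      using assms(1) by (simp add: dim_image_eq)
    with assms(2) show False
      using dim_subset_UNIV[of "range f"] by simp
  qed
  then show ?thesis
    using that linear_injective_0[OF assms(1)] by blast
qed

text \<open>For \<open>y = C x\<close> the second normality equation and its adjoint determine \<open>D y\<close> and \<open>D\<^sup>* y\<close>: the latter is
  \<open>g - f\<close>, and \<open>C\<^sup>*\<close> maps the former to \<open>c\<^sup>2 A x + B (g - f)\<close>. Hence \<open>\<parallel>D y\<parallel>\<^sup>2 - \<parallel>D\<^sup>* y\<parallel>\<^sup>2\<close> is
  \<open>c\<^sup>2 (\<parallel>A x\<parallel>\<^sup>2 - \<parallel>A\<^sup>* x\<parallel>\<^sup>2)\<close> plus the left-hand side below. By the third equation that difference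
  is \<open>c\<^sup>4 \<parallel>x\<parallel>\<^sup>2\<close>, while by the first one \<open>\<parallel>A x\<parallel>\<^sup>2 - \<parallel>A\<^sup>* x\<parallel>\<^sup>2 = - c\<^sup>2 \<parallel>x\<parallel>\<^sup>2\<close>. The two defects have
  opposite signs, which is why the right-hand side is \<open>2 c\<^sup>4 \<parallel>x\<parallel>\<^sup>2\<close> rather than zero.\<close>

lemma defect_identity:
  fixes A B C D :: "complex^'n::finite^'n"
  assumes e1: "A\<^sup>H ** A + C\<^sup>H ** C = A ** A\<^sup>H + B ** B\<^sup>H"
    and e2: "A\<^sup>H ** B + C\<^sup>H ** D = A ** C\<^sup>H + B ** D\<^sup>H"
    and e3: "B\<^sup>H ** B + D\<^sup>H ** D = C ** C\<^sup>H + D ** D\<^sup>H"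
    and iso: "\<And>y. norm (C *v y) = c * norm y" and c: "c \<noteq> 0"
    and x: "B\<^sup>H *v x = 0" "B *v (C *v x) = 0"
    and f: "f = B\<^sup>H *v (A *v x)" and g: "g = C *v (A\<^sup>H *v x)"
  shows "4 * (f \<bullet> g) - 3 * (norm f)\<^sup>2 + (norm (B *v (g - f)))\<^sup>2 / c\<^sup>2 = 2 * c ^ 4 * (norm x)\<^sup>2"
proof -
  define y where "y = C *v x"
  note CC = scaled_isometry_adjoint[OF iso c]
  have sq: "(norm (M *v z))\<^sup>2 = z \<bullet> ((M\<^sup>H ** M) *v z)" for M :: "complex^'n^'n" and z
    by (simp add: power2_norm_eq_inner inner_conj_transpose matrix_vector_mul_assoc)
  have sq': "(norm (M\<^sup>H *v z))\<^sup>2 = z \<bullet> ((M ** M\<^sup>H) *v z)" for M :: "complex^'n^'n" and z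
    using sq[of "M\<^sup>H" z] by simp
  have sqs: "(norm (M *v z))\<^sup>2 + (norm (N *v z))\<^sup>2 = z \<bullet> ((M\<^sup>H ** M + N\<^sup>H ** N) *v z)"
    for M N :: "complex^'n^'n" and z
    by (simp add: sq inner_add_right matrix_vector_mult_add_rdistrib)
  have n1: "(norm (A *v x))\<^sup>2 + (norm (C *v x))\<^sup>2 = (norm (A\<^sup>H *v x))\<^sup>2 + (norm (B\<^sup>H *v x))\<^sup>2"
    by (simp add: sqs e1)
  have n3: "(norm (B *v y))\<^sup>2 + (norm (D *v y))\<^sup>2 = (norm (C\<^sup>H *v y))\<^sup>2 + (norm (D\<^sup>H *v y))\<^sup>2"
    by (simp add: sqs e3)
  have e2': "B\<^sup>H ** A + D\<^sup>H ** C = C ** A\<^sup>H + D ** B\<^sup>H"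
    using arg_cong[OF e2, of conj_transpose] by (simp add: conj_transpose_add conj_transpose_mult)
  have Dstar: "D\<^sup>H *v y = g - f"
    using arg_cong[OF e2', of "\<lambda>M. M *v x"] x
    by (simp add: matrix_vector_mult_add_rdistrib f g y_def eq_diff_eq add.commute
        flip: matrix_vector_mul_assoc)
  have CD: "C\<^sup>H *v (D *v y) = c\<^sup>2 *\<^sub>R (A *v x) + B *v (g - f)"
    using arg_cong[OF e2, of "\<lambda>M. M *v y"] x
    by (simp add: matrix_vector_mult_add_rdistrib Dstar CC matrix_vector_mult_scaleR y_def[symmetric]
        flip: matrix_vector_mul_assoc) (simp add: y_def CC matrix_vector_mult_scaleR)
  have expand: "(norm (k *\<^sub>R a + b))\<^sup>2 = k\<^sup>2 * (norm a)\<^sup>2 + 2 * k * (a \<bullet> b) + (norm b)\<^sup>2"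
    for k and a b :: "complex^'n"
    by (simp only: power2_norm_eq_inner) (simp add: inner_simps inner_commute power2_eq_square)
  have "c\<^sup>2 * (norm (D *v y))\<^sup>2 = (norm (C\<^sup>H *v (D *v y)))\<^sup>2"
    using sq'[of C "D *v y"] by (simp add: CC power2_norm_eq_inner flip: matrix_vector_mul_assoc)
  also have "\<dots> = c ^ 4 * (norm (A *v x))\<^sup>2 + 2 * c\<^sup>2 * ((A *v x) \<bullet> (B *v (g - f))) + (norm (B *v (g - f)))\<^sup>2"
    unfolding CD expand by (simp add: flip: power_mult)
  also have "(A *v x) \<bullet> (B *v (g - f)) = f \<bullet> g - (norm f)\<^sup>2"
    using inner_conj_transpose[of "B\<^sup>H" "A *v x" "g - f"]
    by (simp only: conj_transpose_conj_transpose f[symmetric] inner_diff_right power2_norm_eq_inner)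
  finally have Dy: "(norm (D *v y))\<^sup>2 = c\<^sup>2 * (norm (A *v x))\<^sup>2 + 2 * (f \<bullet> g - (norm f)\<^sup>2) + (norm (B *v (g - f)))\<^sup>2 / c\<^sup>2"
    using c by (simp add: field_simps power4_eq_xxxx power2_eq_square)
  have Dsy: "(norm (D\<^sup>H *v y))\<^sup>2 = c\<^sup>2 * (norm (A\<^sup>H *v x))\<^sup>2 - 2 * (f \<bullet> g) + (norm f)\<^sup>2"
  proof -
    have "(norm (g - f))\<^sup>2 = (norm g)\<^sup>2 - 2 * (f \<bullet> g) + (norm f)\<^sup>2"
      by (simp add: power2_norm_eq_inner inner_diff_left inner_diff_right inner_commute)
    then show ?thesis
      by (simp add: Dstar g iso power_mult_distrib)
  qed
  have "(norm (D *v y))\<^sup>2 = c ^ 4 * (norm x)\<^sup>2 + (norm (D\<^sup>H *v y))\<^sup>2"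
    using n3 x(2) by (simp add: y_def CC power_mult_distrib flip: power_mult)
  moreover have "c\<^sup>2 * (norm (A *v x))\<^sup>2 = c\<^sup>2 * (norm (A\<^sup>H *v x))\<^sup>2 - c ^ 4 * (norm x)\<^sup>2"
  proof -
    have "(norm (A *v x))\<^sup>2 = (norm (A\<^sup>H *v x))\<^sup>2 - c\<^sup>2 * (norm x)\<^sup>2"
      using n1 x(1) by (simp add: iso power_mult_distrib)
    then show ?thesis
      by (simp only:) (simp add: algebra_simps power4_eq_xxxx power2_eq_square)
  qed
  ultimately show ?thesis
    unfolding Dy Dsy by argo
qed

text \<open>Every inequality in \<open>\<parallel>B\<parallel> \<le> \<parallel>B\<parallel>\<^sub>F = \<parallel>C\<parallel>\<^sub>F \<le> \<surd>n \<parallel>C\<parallel>\<close> must be an equality, and the two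
  equality cases are those of \<open>rank_one_if_norm_le\<close> and \<open>scaled_isometry_if_norm_large\<close>.\<close>

lemma extremal_corners:
  fixes A B C :: "complex^'n::finite^'n"
  assumes diag: "A\<^sup>H ** A + C\<^sup>H ** C = A ** A\<^sup>H + B ** B\<^sup>H"
    and extremal: "mat_norm B = sqrt (real CARD('n)) * mat_norm C"
  obtains v w where "norm v = 1" "norm w = sqrt (real CARD('n)) * mat_norm C" "B = outer w v"
    "\<And>x. norm (C *v x) = mat_norm C * norm x"
proof -
  let ?n = "real CARD('n)" and ?c = "mat_norm C"
  obtain v where v: "norm v = 1" "norm (B *v v) = mat_norm B"
    by (rule mat_norm_attained)
  define w where "w = B *v v"
  have w: "norm w = sqrt ?n * ?c"
    by (simp add: w_def v extremal)
  have norm_BC: "norm B = norm C"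
    by (rule normal_block_mat_norm_eq[OF diag])
  have "(norm C)\<^sup>2 \<le> ?n * ?c\<^sup>2"
  proof -
    have "(norm (C *v axis j 1))\<^sup>2 \<le> ?c\<^sup>2" for j
      using norm_matrix_vector_le[of C "axis j 1"] by (simp add: norm_axis power_mono)
    then have "(\<Sum>j\<in>UNIV. (norm (C *v axis j 1))\<^sup>2) \<le> (\<Sum>j\<in>(UNIV::'n set). ?c\<^sup>2)"
      by (intro sum_mono)
    then show ?thesis
      by (simp add: norm_matrix_sq_columns)
  qed
  then have "(norm B)\<^sup>2 \<le> (norm w)\<^sup>2"
    by (simp add: norm_BC w power_mult_distrib)
  then have "norm B \<le> norm w"
    by simp
  then have B: "B = outer w v"
    unfolding w_def by (intro rank_one_if_norm_le v(1))
  have "(norm w)\<^sup>2 = (norm B)\<^sup>2"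
    by (simp add: B norm_outer v(1))
  then have "?n * ?c\<^sup>2 \<le> (norm C)\<^sup>2"
    by (simp add: norm_BC w power_mult_distrib)
  then have "norm (C *v x) = ?c * norm x" for x
    by (intro scaled_isometry_if_norm_large norm_matrix_vector_le)
  with that v(1) w B show ?thesis
    by blast
qed

text \<open>The left-hand side of \<open>defect_identity\<close>, multiplied by \<open>\<parallel>B\<parallel>\<^sup>2\<close>, becomes
  \<open>\<parallel>F - 2 G\<parallel>\<^sup>2 + (n - 4) \<parallel>G - F\<parallel>\<^sup>2\<close> with \<open>F = B f\<close> and \<open>G = B g\<close> on the line spanned by \<open>w\<close>.
  The linear conditions \<open>B\<^sup>* x = 0\<close>, \<open>B C x = 0\<close> and \<open>F = 2 G\<close> are one complex equation each, and
  when \<open>n = 4\<close> these three make the expression vanish; when \<open>n > 4\<close> there is room for the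
  fourth equation \<open>F = G\<close>. In both cases fewer than \<open>n\<close> equations are imposed, so a nonzero \<open>x\<close>
  satisfies them, although the right-hand side of the identity is a positive multiple of
  \<open>\<parallel>x\<parallel>\<^sup>2\<close>.\<close>

lemma no_extremal_normal_block_mat:
  fixes A B C D :: "complex^'n::finite^'n"
  assumes normal: "normal_matrix (block_mat A B C D)" and B: "B \<noteq> 0"
    and extremal: "mat_norm B = sqrt (real CARD('n)) * mat_norm C"
  shows "CARD('n) \<le> 3"
proof (rule ccontr)
  assume large: "\<not> CARD('n) \<le> 3"
  let ?n = "real CARD('n)"
  define c where "c = mat_norm C"
  have eqs: "A\<^sup>H ** A + C\<^sup>H ** C = A ** A\<^sup>H + B ** B\<^sup>H"
    "A\<^sup>H ** B + C\<^sup>H ** D = A ** C\<^sup>H + B ** D\<^sup>H"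
    "B\<^sup>H ** B + D\<^sup>H ** D = C ** C\<^sup>H + D ** D\<^sup>H"
    using normal by (simp_all add: normal_block_mat_iff)
  obtain v w where v: "norm v = 1" and w: "norm w = sqrt ?n * c" and B_eq: "B = outer w v"
    and iso: "\<And>x. norm (C *v x) = c * norm x"
    using extremal_corners[OF eqs(1) extremal] unfolding c_def by metis
  have Bx: "B *v x = cdot v x *s w" and Bsx: "B\<^sup>H *v x = cdot w x *s v" for x
    by (simp_all add: B_eq outer_mult_vec conj_transpose_outer)
  have "w \<noteq> 0"
    using B B_eq by (auto simp: outer_def vec_eq_iff)
  then have c: "c \<noteq> 0"
    using w by auto
  \<comment> \<open>\<open>B / \<parallel>B\<parallel>\<close> is a partial isometry, so applying \<open>B\<close> only rescales inner products with a
    vector in the range of \<open>B\<^sup>*\<close>.\<close>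
  have BBB: "B\<^sup>H *v (B *v (B\<^sup>H *v x)) = (?n * c\<^sup>2) *\<^sub>R (B\<^sup>H *v x)" for x
    by (simp add: Bx Bsx cdot_scale cdot_self v w power_mult_distrib vec_eq_iff)
      (simp add: scaleR_conv_of_real)
  define f where "f = (\<lambda>x. B\<^sup>H *v (A *v x))"
  define g where "g = (\<lambda>x. C *v (A\<^sup>H *v x))"
  have fg: "linear f" "linear g"
    unfolding f_def g_def by (auto intro!: linearI simp: matrix_vector_right_distrib matrix_vector_mult_scaleR)
  have linear_Ls: "linear (\<lambda>x. cdot w x)" "linear (\<lambda>x. cdot v (C *v x))"
    "linear (\<lambda>x. cdot v (f x - 2 *\<^sub>R g x))" "linear (\<lambda>x. cdot v (g x - f x))"
    by (rule linearI; simp add: linear_add[OF fg(1)] linear_add[OF fg(2)] linear_scale[OF fg(1)]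
        linear_scale[OF fg(2)] matrix_vector_right_distrib matrix_vector_mult_scaleR cdot_add cdot_diff
        cdot_scaleR algebra_simps)+
  have linear_Pair: "linear (\<lambda>x. (h x, k x))" if "linear h" "linear k"
    for h :: "complex^'n \<Rightarrow> complex" and k :: "complex^'n \<Rightarrow> 'b::real_vector"
    using that by (simp add: linear_iff)
  have "\<exists>x. x \<noteq> 0 \<and> cdot w x = 0 \<and> cdot v (C *v x) = 0 \<and> cdot v (f x - 2 *\<^sub>R g x) = 0 \<and>
    (CARD('n) = 4 \<or> cdot v (g x - f x) = 0)"
  proof (cases "CARD('n) = 4")
    case True
    have "linear (\<lambda>x. (cdot w x, cdot v (C *v x), cdot v (f x - 2 *\<^sub>R g x)))"
      by (intro linear_Pair linear_Ls)
    then obtain x where "x \<noteq> 0" "(cdot w x, cdot v (C *v x), cdot v (f x - 2 *\<^sub>R g x)) = 0"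
      by (rule linear_has_kernel) (simp add: True)
    with True show ?thesis
      by (auto simp: zero_prod_def)
  next
    case False
    have "linear (\<lambda>x. (cdot w x, cdot v (C *v x), cdot v (f x - 2 *\<^sub>R g x), cdot v (g x - f x)))"
      by (intro linear_Pair linear_Ls)
    then obtain x where "x \<noteq> 0"
      "(cdot w x, cdot v (C *v x), cdot v (f x - 2 *\<^sub>R g x), cdot v (g x - f x)) = 0"
      by (rule linear_has_kernel) (use False large in simp)
    then show ?thesis
      by (auto simp: zero_prod_def)
  qed
  then obtain x where x: "x \<noteq> 0" "B\<^sup>H *v x = 0" "B *v (C *v x) = 0"
    "B *v (f x - 2 *\<^sub>R g x) = 0" "CARD('n) = 4 \<or> B *v (g x - f x) = 0"
    unfolding Bx Bsx by auto
  define F where "F = B *v f x"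
  define G where "G = B *v g x"
  have FG: "F = 2 *\<^sub>R G" "(?n - 4) * (norm (G - F))\<^sup>2 = 0"
    using x(4,5) by (auto simp: F_def G_def matrix_vector_mult_diff_distrib matrix_vector_mult_scaleR)
  have inner_F: "F \<bullet> (B *v y) = ?n * c\<^sup>2 * (f x \<bullet> y)" for y
    using inner_conj_transpose[of "B\<^sup>H" F y] by (simp add: F_def f_def BBB)
  have "4 * (f x \<bullet> g x) - 3 * (norm (f x))\<^sup>2 + (norm (G - F))\<^sup>2 / c\<^sup>2 = 2 * c ^ 4 * (norm x)\<^sup>2"
    using defect_identity[OF eqs iso c x(2,3) f_def[THEN fun_cong] g_def[THEN fun_cong]]
    by (simp add: F_def G_def matrix_vector_mult_diff_distrib)
  then have "?n * c\<^sup>2 * (2 * c ^ 4 * (norm x)\<^sup>2) =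
    ?n * c\<^sup>2 * (4 * (f x \<bullet> g x) - 3 * (norm (f x))\<^sup>2 + (norm (G - F))\<^sup>2 / c\<^sup>2)"
    by simp
  also have "\<dots> = 4 * (F \<bullet> G) - 3 * (norm F)\<^sup>2 + ?n * (norm (G - F))\<^sup>2"
    using inner_F[of "g x"] inner_F[of "f x"] c
    by (simp add: F_def[symmetric] G_def[symmetric] power2_norm_eq_inner field_simps)
  also have "\<dots> = (norm (F - 2 *\<^sub>R G))\<^sup>2 + (?n - 4) * (norm (G - F))\<^sup>2"
    by (simp only: power2_norm_eq_inner) (simp add: inner_simps inner_commute algebra_simps)
  also have "\<dots> = 0"
    using FG by simp
  finally show False
    using c x(1) by simp
qed

section \<open>Examples with blocks of size at most three\<close>

lemma mat_norm_eqI: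
  fixes M :: "complex^'n::finite^'m::finite"
  assumes "\<And>x. norm (M *v x) \<le> c * norm x" "norm (M *v v) = c * norm v" "v \<noteq> 0"
  shows "mat_norm M = c"
proof (rule antisym)
  show "mat_norm M \<le> c"
    unfolding mat_norm_def using assms(1) by (rule onorm_le)
  show "c \<le> mat_norm M"
    using norm_matrix_vector_le[of M v] assms(2,3) by simp
qed

lemma mat_norm_mat_1: "mat_norm (mat 1 :: complex^'n::finite^'n) = 1"
  by (rule mat_norm_eqI[where v = "axis undefined 1"]) (simp_all add: axis_eq_0_iff)

definition unit_mat :: "'n \<Rightarrow> 'n \<Rightarrow> real \<Rightarrow> complex^'n^'n" where
  "unit_mat i j r = (\<chi> p q. if p = i \<and> q = j then of_real r else 0)"

lemma unit_mat_nth: "unit_mat i j r $ p $ q = (if p = i \<and> q = j then of_real r else 0)"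
  by (simp add: unit_mat_def)

lemma unit_mat_mult:
  fixes i :: "'n::finite"
  shows "unit_mat i j r ** unit_mat k l t = (if j = k then unit_mat i l (r * t) else 0)"
proof -
  have "(\<Sum>m\<in>UNIV. unit_mat i j r $ p $ m * unit_mat k l t $ m $ q) =
      (\<Sum>m\<in>UNIV. if m = j then if p = i \<and> k = j \<and> q = l then of_real (r * t) else 0 else 0)" for p q
    by (intro sum.cong) (auto simp: unit_mat_nth)
  then show ?thesis
    by (auto simp: matrix_matrix_mult_def vec_eq_iff unit_mat_nth)
qed

lemma conj_transpose_unit_mat: "(unit_mat i j r)\<^sup>H = unit_mat j i r"
  by (simp add: conj_transpose_def vec_eq_iff unit_mat_nth)

lemma conj_transpose_mat_1: "(mat 1)\<^sup>H = mat 1"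
  by (simp add: conj_transpose_def mat_def vec_eq_iff)

lemma conj_transpose_zero: "0\<^sup>H = 0"
  by (simp add: conj_transpose_def vec_eq_iff)

lemma matrix_add_rdistrib: "(M + M') ** N = M ** N + M' ** (N :: complex^'k^'n::finite)"
  by (simp add: matrix_matrix_mult_def vec_eq_iff distrib_right sum.distrib)

lemma mat_norm_unit_mat: "mat_norm (unit_mat i j r :: complex^'n::finite^'n) = \<bar>r\<bar>"
proof (rule mat_norm_eqI)
  have ux: "unit_mat i j r *v x = axis i (of_real r * x $ j)" for x
  proof -
    have "(\<Sum>q\<in>UNIV. unit_mat i j r $ p $ q * x $ q) =
        (\<Sum>q\<in>UNIV. if q = j then if p = i then of_real r * x $ j else 0 else 0)" for p
      by (intro sum.cong) (auto simp: unit_mat_nth)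
    then show ?thesis
      by (simp add: matrix_vector_mult_def vec_eq_iff axis_def)
  qed
  show "norm (unit_mat i j r *v x) \<le> \<bar>r\<bar> * norm x" for x
    by (auto simp: ux norm_axis norm_mult intro!: mult_left_mono Finite_Cartesian_Product.norm_nth_le)
  show "norm (unit_mat i j r *v axis j 1) = \<bar>r\<bar> * norm (axis j 1 :: complex^'n)"
    by (simp add: ux norm_axis norm_mult)
qed (simp add: axis_eq_0_iff)

lemmas unit_mat_simps = matrix_add_ldistrib matrix_add_rdistrib unit_mat_mult
  conj_transpose_unit_mat conj_transpose_add conj_transpose_zero

lemma normal_block_mat_identity_iff:
  fixes A B D :: "complex^'n::finite^'n"
  shows "normal_matrix (block_mat A B (mat 1) D) \<longleftrightarrow>
    A\<^sup>H ** A + mat 1 = A ** A\<^sup>H + B ** B\<^sup>H \<and>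
    A\<^sup>H ** B + D = A + B ** D\<^sup>H \<and>
    B\<^sup>H ** B + D\<^sup>H ** D = mat 1 + D ** D\<^sup>H"
  by (simp add: normal_block_mat_iff conj_transpose_mat_1)

lemma normal_block_mat_1:
  assumes "(UNIV :: 'n::finite set) = {i}"
  shows "normal_matrix (block_mat (0 :: complex^'n^'n) (unit_mat i i 1) (mat 1) 0)"
proof -
  have all: "(\<forall>p. P p) \<longleftrightarrow> P i" for P
    using assms by (metis UNIV_I singletonD)
  show ?thesis
    by (simp add: normal_block_mat_identity_iff unit_mat_simps) (simp add: vec_eq_iff unit_mat_nth mat_def all)
qed

lemma normal_block_mat_2:
  assumes "(UNIV :: 'n::finite set) = {i, j}" and "i \<noteq> j"
  shows "normal_matrix (block_mat (unit_mat j i 1) (unit_mat i j (sqrt 2)) (mat 1) (unit_mat j i 1)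
    :: complex^('n + 'n)^('n + 'n))"
proof -
  have all: "(\<forall>p. P p) \<longleftrightarrow> P i \<and> P j" for P
    using assms(1) by (metis UNIV_I insertE singletonD)
  show ?thesis
    using assms(2) assms(2)[symmetric]
    by (simp add: normal_block_mat_identity_iff unit_mat_simps) (simp add: vec_eq_iff unit_mat_nth mat_def all)
qed

text \<open>With \<open>u = e\<^sub>i\<close> and \<open>v = e\<^sub>j\<close> the normality equations ask for \<open>A\<^sup>* A - A A\<^sup>* = diag(2, -1, -1)\<close> and
  \<open>D\<^sup>* D - D D\<^sup>* = diag(1, -2, 1)\<close>, where \<open>B = \<surd>3 u v\<^sup>*\<close> and the basis is ordered \<open>i, j, k\<close>. Cyclic shifts
  \<open>i \<mapsto> j \<mapsto> k \<mapsto> i\<close> with squared weights \<open>(s\<^sup>2, s\<^sup>2 - 1, s\<^sup>2 - 2)\<close> and \<open>(s\<^sup>2, s\<^sup>2 - 2, s\<^sup>2 - 1)\<close> achieve this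
  whenever \<open>s\<^sup>2 \<ge> 2\<close>; so \<open>D\<close> is \<open>A\<close> with the two weights \<open>a\<close> and \<open>b\<close> exchanged. The remaining equation
  \<open>A\<^sup>* B + D = A + B D\<^sup>*\<close> then reduces to \<open>a - b = \<surd>3 b\<close>.\<close>

lemma normal_block_mat_3:
  fixes a b s :: real
  assumes "(UNIV :: 'n::finite set) = {i, j, k}" and "i \<noteq> j" "j \<noteq> k" "i \<noteq> k"
    and a: "a = b + sqrt 3 * b" "a\<^sup>2 = b\<^sup>2 + 1" and s: "s\<^sup>2 = b\<^sup>2 + 2"
  shows "normal_matrix (block_mat
      (unit_mat i k b + unit_mat j i s + unit_mat k j a) (unit_mat i j (sqrt 3))
      (mat 1) (unit_mat i k a + unit_mat j i s + unit_mat k j b)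
    :: complex^('n + 'n)^('n + 'n))"
proof -
  have all: "(\<forall>p. P p) \<longleftrightarrow> P i \<and> P j \<and> P k" for P
    using assms(1) by (metis UNIV_I insertE singletonD)
  have products: "a * a = b * b + 1" "s * s = b * b + 2" "sqrt 3 * b = a - b" "b * sqrt 3 = a - b"
    using a s by (simp_all add: power2_eq_square)
  show ?thesis
    using assms(2-4) assms(2-4)[symmetric]
    by (simp add: normal_block_mat_identity_iff unit_mat_simps products)
      (simp add: vec_eq_iff unit_mat_nth mat_def all)
qed

lemma extremal_normal_block_mat_exists:
  assumes "CARD('n::finite) \<le> 3"
  shows "\<exists>A D i j. normal_matrix (block_mat A (unit_mat i j (sqrt (real CARD('n)))) (mat 1) D
    :: complex^('n + 'n)^('n + 'n))"
proof -
  have "CARD('n) \<noteq> 0"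
    by simp
  then consider "CARD('n) = 1" | "CARD('n) = 2" | "CARD('n) = 3"
    using assms by linarith
  then show ?thesis
  proof cases
    case 1
    then obtain i where "(UNIV :: 'n set) = {i}"
      by (auto simp: card_1_singleton_iff)
    with normal_block_mat_1[OF this] 1 show ?thesis
      by auto
  next
    case 2
    then obtain i j where "(UNIV :: 'n set) = {i, j}" "i \<noteq> j"
      by (auto simp: card_2_iff)
    with normal_block_mat_2[OF this] 2 show ?thesis
      by auto
  next
    case 3
    then obtain i j k where ijk: "(UNIV :: 'n set) = {i, j, k}" "i \<noteq> j" "j \<noteq> k" "i \<noteq> k"
      by (auto simp: card_3_iff)
    \<comment> \<open>\<open>a = (1 + \<surd>3) b\<close> and \<open>a\<^sup>2 = b\<^sup>2 + 1\<close> together force \<open>(3 + 2 \<surd>3) b\<^sup>2 = 1\<close>.\<close>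
    define b where "b = sqrt (1 / (3 + 2 * sqrt 3))"
    define s where "s = sqrt (b\<^sup>2 + 2)"
    have "3 + 2 * sqrt 3 > 0"
      by (simp add: add_pos_nonneg)
    then have "b\<^sup>2 * (3 + 2 * sqrt 3) = 1"
      by (simp add: b_def)
    then have "(b + sqrt 3 * b)\<^sup>2 = b\<^sup>2 + 1"
      by (simp add: power2_eq_square algebra_simps)
    moreover have "s\<^sup>2 = b\<^sup>2 + 2"
      by (simp add: s_def)
    ultimately show ?thesis
      using normal_block_mat_3[OF ijk refl] 3 by (metis of_nat_numeral)
  qed
qed

theorem theorem1:
  "(\<exists>(N :: complex^('n::finite + 'n)^('n + 'n)) A B C D.
      N = block_mat A B C D \<and> normal_matrix N \<and> B \<noteq> 0 \<and>
      mat_norm B = sqrt (real CARD('n)) * mat_norm C)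
   \<longleftrightarrow> CARD('n) \<le> 3"
proof
  assume "CARD('n) \<le> 3"
  then obtain A D :: "complex^'n^'n" and i j
    where normal: "normal_matrix (block_mat A (unit_mat i j (sqrt (real CARD('n)))) (mat 1) D)"
    using extremal_normal_block_mat_exists by blast
  let ?B = "unit_mat i j (sqrt (real CARD('n)))"
  have B: "mat_norm ?B = sqrt (real CARD('n)) * mat_norm (mat 1 :: complex^'n^'n)"
    by (simp add: mat_norm_unit_mat mat_norm_mat_1)
  moreover have "?B $ i $ j \<noteq> 0"
    by (simp add: unit_mat_nth)
  then have "?B \<noteq> 0"
    by force
  ultimately show "\<exists>(N :: complex^('n + 'n)^('n + 'n)) A B C D.
      N = block_mat A B C D \<and> normal_matrix N \<and> B \<noteq> 0 \<and>
      mat_norm B = sqrt (real CARD('n)) * mat_norm C"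
    using normal by blast
qed (use no_extremal_normal_block_mat in blast)

end
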